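(* Consider $y=Ax^*+\varepsilon$ with $A\in\mathbb R^{M\times N}$ having columns $a_1,\dots,a_N$ such that $\max_{i}\|a_i\|_2<1$, $\varepsilon\in\mathbb R^M\setminus\{0\}$, and $x^*$ with support $\sigma^*$, $k^*=\#\sigma^*\ge1$. Let $F(x)=\frac12\|Ax-y\|_2^2$, $\gamma=1$, $\tilde L=L=1$, let $K\in\mathbb N$ with $2k^*\le K\le N$, assume $A$ satisfies (LRIP) for $K$ with constant $\delta_K^-<1$, and let $C_K=1-\delta_K^-$. Then the quantities $$\underline\Lambda:=F(x^* )\max\left\{\frac{\tilde L}{\gamma\min\{C_K^2,1\}}\max_{i\in{\sigma^*}^c}\|a_i\|_2^2,\ \frac1{1+K-2k^*}\right\},\qquad\bar\Lambda:=\frac\gamma2\min\{C_K^2,1\}\left(\min_{i\in\sigma^*}|x_i^*|-\sqrt{\frac{2F(x^* )}{\gamma C_K}}\right)^2$$ satisfy $$\underline\Lambda<\frac{\|\varepsilon\|_2^2}{2\min\{(1-\delta_K^-)^2,1\}},\qquad\bar\Lambda=\frac{\min\{(1-\delta_K^-)^2,1\}}2\left(\min_{i\in\sigma^*}|x_i^*|-\frac{\|\varepsilon\|_2}{\sqrt{1-\delta_K^-}}\right)^2.$$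
   Context: (LRIP): $A$ satisfies (LRIP) for $K$ with constant $\delta_K^-<1$ if $A_\omega^TA_\omega\succcurlyeq(1-\delta_K^-)\mathrm{Id}$ for all $\omega\subseteq\{1,\dots,N\}$ with $\#\omega\le K$, where $A_\omega$ is the submatrix of columns of $A$ indexed by $\omega$ and $\succcurlyeq$ is the Loewner order. ${\sigma^*}^c$ denotes the complement of $\sigma^*$ in $\{1,\dots,N\}$. The setting is that of least squares with generating function $\Psi=\frac12\|\cdot\|_2^2$, for which $C_K=1-\delta_K^-$ is the Bregman Restricted Strong Convexity constant and the least-squares loss has gradient Lipschitz constant $1$. *)

theory Defs
  imports
    "HOL-Analysis.L2_Norm"
    "Jordan_Normal_Form.DL_Submatrix"
begin

text \<open>Indices are 0-based: columns are indexed by $\{0,\dots,N-1\}$ instead of $\{1,\dots,N\}$.\<close>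

definition l2norm :: "real vec \<Rightarrow> real" where
  "l2norm v = L2_set (\<lambda>i. v $ i) {0..<dim_vec v}"

definition supp :: "real vec \<Rightarrow> nat set" where
  "supp x = {i \<in> {0..<dim_vec x}. x $ i \<noteq> 0}"

definition psd :: "real mat \<Rightarrow> bool" where
  "psd P \<longleftrightarrow> square_mat P \<and> transpose_mat P = P \<and>
     (\<forall>z \<in> carrier_vec (dim_row P). 0 \<le> z \<bullet> (P *\<^sub>v z))"

text \<open>The dimension guard is needed because matrix subtraction is total.\<close>

definition loewner_ge :: "real mat \<Rightarrow> real mat \<Rightarrow> bool" where
  "loewner_ge P Q \<longleftrightarrow> dim_row P = dim_row Q \<and> dim_col P = dim_col Q \<and> psd (P - Q)"

definition col_submatrix :: "real mat \<Rightarrow> nat set \<Rightarrow> real mat" where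
  "col_submatrix A \<omega> = submatrix A UNIV \<omega>"

definition LRIP :: "real mat \<Rightarrow> nat \<Rightarrow> real \<Rightarrow> bool" where
  "LRIP A K \<delta> \<longleftrightarrow> \<delta> < 1 \<and>
     (\<forall>\<omega> \<subseteq> {0..<dim_col A}. card \<omega> \<le> K \<longrightarrow>
        loewner_ge (transpose_mat (col_submatrix A \<omega>) * col_submatrix A \<omega>)
                   ((1 - \<delta>) \<cdot>\<^sub>m 1\<^sub>m (card \<omega>)))"

definition least_squares :: "real mat \<Rightarrow> real vec \<Rightarrow> real vec \<Rightarrow> real" where
  "least_squares A y x = 1 / 2 * (l2norm (A *\<^sub>v x - y))\<^sup>2"

text \<open>
  Lower and upper bounds on the regularization parameter. The argument \<open>F\<close> is the data
  fidelity, \<open>Lt\<close> stands for $\tilde L$, \<open>C\<close> for $C_K$, and \<open>x\<close> for $x^*$. The \<open>MAX\<close> and \<open>MIN\<close>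
  are meaningful only if the support of \<open>x\<close> is nonempty and not all of the index set.
\<close>

definition Lambda_lower ::
    "(real vec \<Rightarrow> real) \<Rightarrow> real mat \<Rightarrow> real \<Rightarrow> real \<Rightarrow> real \<Rightarrow> nat \<Rightarrow> real vec \<Rightarrow> real" where
  "Lambda_lower F A Lt \<gamma> C K x =
     F x * max (Lt / (\<gamma> * min (C\<^sup>2) 1) * (MAX i \<in> {0..<dim_vec x} - supp x. (l2norm (col A i))\<^sup>2))
               (1 / (1 + real K - 2 * real (card (supp x))))"

definition Lambda_upper ::
    "(real vec \<Rightarrow> real) \<Rightarrow> real \<Rightarrow> real \<Rightarrow> real vec \<Rightarrow> real" where
  "Lambda_upper F \<gamma> C x =
     \<gamma> / 2 * min (C\<^sup>2) 1 * ((MIN i \<in> supp x. \<bar>x $ i\<bar>) - sqrt (2 * F x / (\<gamma> * C)))\<^sup>2"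

end

theory Submission
  imports Defs
begin

text \<open>
  At \<open>xs\<close> the residual is \<open>-eps\<close>, so the loss there is half the squared norm of \<open>eps\<close>. The formula
  for the upper bound is then immediate, and the strict inequality for the lower bound amounts to
  comparing each of the two terms of the maximum with \<open>1 / min (C\<^sup>2) 1\<close>. The first term is smaller
  because the columns have norm less than one. The second is smaller because (LRIP) on a
  one-element index set gives \<open>C \<le> (l2norm (col A i))\<^sup>2 < 1\<close>; only the case \<open>K = 2 * k\<close> needs this.
\<close>

lemma l2norm_nonneg: "0 \<le> l2norm v"
  by (simp add: l2norm_def)

lemma l2norm_uminus: "l2norm (- v) = l2norm v"
  by (simp add: l2norm_def L2_set_def)

lemma l2norm_eq_0_iff: "l2norm v = 0 \<longleftrightarrow> v = 0\<^sub>v (dim_vec v)"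
proof
  assume "l2norm v = 0"
  then show "v = 0\<^sub>v (dim_vec v)"
    by (intro eq_vecI) (simp_all add: l2norm_def L2_set_eq_0_iff)
next
  assume "v = 0\<^sub>v (dim_vec v)"
  then obtain n where "v = 0\<^sub>v n"
    by blast
  then show "l2norm v = 0"
    by (simp add: l2norm_def L2_set_eq_0_iff)
qed

lemma l2norm_sq: "(l2norm v)\<^sup>2 = v \<bullet> v"
  by (simp add: l2norm_def L2_set_def sum_nonneg scalar_prod_def power2_eq_square)

lemma col_submatrix_singleton:
  assumes "i < dim_col A"
  shows "col_submatrix A {i} = mat (dim_row A) 1 (\<lambda>(r, _). A $$ (r, i))"
proof -
  \<comment> \<open>The cardinality of this set is the column count in \<open>submatrix\<close>;
    \<open>pick {i} 0\<close>, a least element, is the source index of its only column.\<close>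
  have "{j. j < dim_col A \<and> j \<in> {i}} = {i}"
    using assms by auto
  moreover have "pick {i} 0 = i"
    by (auto intro: Least_equality)
  ultimately show ?thesis
    by (intro eq_matI) (simp_all add: col_submatrix_def submatrix_def pick_UNIV del: pick.simps)
qed

text \<open>For a single column the Gram matrix is 1 by 1, with the squared column norm as its
  entry, so the Loewner bound becomes a scalar inequality.\<close>

lemma LRIP_le_col_norm:
  assumes "LRIP A K \<delta>" "1 \<le> K" "i < dim_col A"
  shows "1 - \<delta> \<le> (l2norm (col A i))\<^sup>2"
proof -
  let ?B = "col_submatrix A {i}"
  let ?P = "transpose_mat ?B * ?B - (1 - \<delta>) \<cdot>\<^sub>m 1\<^sub>m 1"
  have B: "?B = mat (dim_row A) 1 (\<lambda>(r, _). A $$ (r, i))"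
    by (rule col_submatrix_singleton[OF assms(3)])
  have colB: "col ?B 0 = col A i"
    using assms(3) by (auto simp: B)
  have "psd ?P"
    using assms unfolding LRIP_def loewner_ge_def
    by (force dest: spec[of _ "{i}"])
  moreover have dim: "dim_row ?P = 1" "dim_col ?P = 1"
    by (simp_all add: B)
  \<comment> \<open>Testing semidefiniteness on the unit vector reads off the only entry of
    \<open>?P\<close>.\<close>
  ultimately have "0 \<le> unit_vec 1 0 \<bullet> (?P *\<^sub>v unit_vec 1 0)"
    unfolding psd_def by (metis unit_vec_carrier)
  also have "\<dots> = ?P $$ (0, 0)"
    using dim by (simp add: scalar_prod_def)
  also have "\<dots> = col ?B 0 \<bullet> col ?B 0 - (1 - \<delta>)"
    by (simp add: B)
  finally show ?thesis
    by (simp add: colB l2norm_sq)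
qed

lemma least_squares_at_truth:
  assumes "A \<in> carrier_mat M N" "eps \<in> carrier_vec M"
  shows "least_squares A (A *\<^sub>v x + eps) x = (l2norm eps)\<^sup>2 / 2"
proof -
  have "A *\<^sub>v x - (A *\<^sub>v x + eps) = - eps"
    using assms by (intro eq_vecI) auto
  then show ?thesis
    by (simp add: least_squares_def l2norm_uminus)
qed

theorem proposition6p3:
  fixes A :: "real mat" and xs eps y :: "real vec" and M N K k :: nat
    and \<sigma> :: "nat set" and F :: "real vec \<Rightarrow> real" and \<delta> C \<gamma> L Lt :: real
  assumes A: "A \<in> carrier_mat M N"
    and xs: "xs \<in> carrier_vec N"
    and eps: "eps \<in> carrier_vec M" "eps \<noteq> 0\<^sub>v M"
    and y: "y = A *\<^sub>v xs + eps"
    and cols: "(MAX i \<in> {0..<N}. l2norm (col A i)) < 1"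
    and support: "\<sigma> = supp xs" "k = card \<sigma>" "1 \<le> k"
    and F: "F = least_squares A y"
    and params: "\<gamma> = 1" "Lt = L" "L = 1"
    and K: "2 * k \<le> K" "K \<le> N"
    and lrip: "LRIP A K \<delta>"
    and C: "C = 1 - \<delta>"
  shows "Lambda_lower F A Lt \<gamma> C K xs < (l2norm eps)\<^sup>2 / (2 * min ((1 - \<delta>)\<^sup>2) 1) \<and>
         Lambda_upper F \<gamma> C xs =
           min ((1 - \<delta>)\<^sup>2) 1 / 2 *
             ((MIN i \<in> \<sigma>. \<bar>xs $ i\<bar>) - l2norm eps / sqrt (1 - \<delta>))\<^sup>2"
proof
  have Fxs: "F xs = (l2norm eps)\<^sup>2 / 2"
    unfolding F y by (rule least_squares_at_truth[OF A eps(1)])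
  have C_pos: "0 < C"
    using lrip C by (simp add: LRIP_def)
  have supp_sub: "\<sigma> \<subseteq> {0..<N}"
    using support(1) xs by (auto simp: supp_def)
  have col_lt: "l2norm (col A i) < 1" if "i < N" for i
    using cols that by (subst (asm) Max_less_iff) auto
  then have col_sq_lt: "(l2norm (col A i))\<^sup>2 < 1" if "i < N" for i
    using that by (simp add: power_less_one_iff l2norm_nonneg)
  \<comment> \<open>Any column would do; column 0 exists because 2 \<le> 2k \<le> K \<le> N.\<close>
  have "C \<le> (l2norm (col A 0))\<^sup>2"
    unfolding C by (rule LRIP_le_col_norm[OF lrip]) (use K support A in auto)
  also have "\<dots> < 1"
    using K support by (intro col_sq_lt) simp
  finally have C_lt: "C < 1" .
  define m where "m = min (C\<^sup>2) 1"
  have m: "0 < m" "m < 1"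
    using C_pos C_lt by (simp_all add: m_def power_less_one_iff)
  \<comment> \<open>The \<open>MAX\<close> below needs a nonempty index set. A full support would
    give k = N, hence 2N \<le> K \<le> N, contradicting k \<ge> 1.\<close>
  have "{0..<N} - \<sigma> \<noteq> {}"
  proof
    assume "{0..<N} - \<sigma> = {}"
    then have "\<sigma> = {0..<N}"
      using supp_sub by auto
    then show False
      using support K by simp
  qed
  then have "(MAX i \<in> {0..<N} - \<sigma>. (l2norm (col A i))\<^sup>2) < 1"
    using col_sq_lt by (subst Max_less_iff) auto
  then have "1 / m * (MAX i \<in> {0..<N} - \<sigma>. (l2norm (col A i))\<^sup>2) < 1 / m"
    using m by (simp add: divide_strict_right_mono)
  \<comment> \<open>The denominator is at least 1, and \<open>m\<close> is strictly below 1.\<close>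
  moreover have "1 / (1 + real K - 2 * real k) < 1 / m"
  proof -
    have "1 \<le> 1 + real K - 2 * real k"
      using K(1) by linarith
    then show ?thesis
      using m by (intro divide_strict_left_mono) auto
  qed
  \<comment> \<open>Nonzero noise keeps the inequality strict after scaling by
    \<open>F xs\<close>.\<close>
  moreover have "0 < F xs"
    using eps l2norm_eq_0_iff[of eps] by (auto simp: Fxs)
  ultimately have "F xs * max (1 / m * (MAX i \<in> {0..<N} - \<sigma>. (l2norm (col A i))\<^sup>2))
      (1 / (1 + real K - 2 * real k)) < F xs * (1 / m)"
    by (intro mult_strict_left_mono) auto
  then have "Lambda_lower F A Lt \<gamma> C K xs < F xs * (1 / m)"
    using xs by (simp add: Lambda_lower_def m_def support params)
  then show "Lambda_lower F A Lt \<gamma> C K xs < (l2norm eps)\<^sup>2 / (2 * min ((1 - \<delta>)\<^sup>2) 1)"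
    by (simp add: Fxs m_def C)
  have "sqrt (2 * F xs / (\<gamma> * C)) = l2norm eps / sqrt (1 - \<delta>)"
    by (simp add: Fxs params C real_sqrt_divide l2norm_nonneg)
  then show "Lambda_upper F \<gamma> C xs =
      min ((1 - \<delta>)\<^sup>2) 1 / 2 * ((MIN i \<in> \<sigma>. \<bar>xs $ i\<bar>) - l2norm eps / sqrt (1 - \<delta>))\<^sup>2"
    by (simp add: Lambda_upper_def params C support)
qed

end
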